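(* Let $P\colon\mathcal E\to\mathcal B$ be a Grothendieck fibration, $K$ and $K'$ covering functions on $\mathcal B$ satisfying axiom $(\tilde{\mathrm M})$, and $\mathrm{Triv}\subset P$ a subfunctor of trivial objects that is a replete, globally full, strong subfibration of $P$. Suppose $K_l\preceq K'_l$. (i) Then every object locally trivial in $K$ is locally trivial in $K'$. In particular, when $K_l\equiv K'_l$, $K$ and $K'$ have the same locally trivial objects. (ii) If, moreover, $K_l$ and $K'_l$ are coverages, then $\mathrm{Loc}(K)$ is a replete, globally full, strong subfibration of $\mathrm{Loc}(K')$.
   Context: A covering of an object $C$ is a class of arrows with codomain $C$; a covering function $K$ on a category assigns to each object a collection of coverings of it. $R$ refines $S$ (coverings of the same object) if each arrow of $R$ factors through an arrow of $S$. $K\preceq K'$ means each $K$-covering has a refinement belonging to $K'$; $K\equiv K'$ means $K\preceq K'$ and $K'\preceq K$. Axiom $(\tilde{\mathrm M})$: for each isomorphism $f\colon D\to C$, $\{f\}\in K(C)$. A covering function $K$ is a coverage if for each object $C$, each $K$-covering $R$ of $C$ and each arrow $g\colon D\to C$ of the category on which $K$ is defined, there is a $K$-covering $S$ of $D$ such that $g\circ S=\{g\circ h\mid h\in S\}$ refines $R$. A subfunctor of a functor $P\colon\mathcal E\to\mathcal B$ is a functor $\bar P\colon\mathcal D\to\mathcal A$ with $\mathcal D\subset\mathcal E$, $\mathcal A\subset\mathcal B$ subcategories and $\bar P$ the restriction of $P$. It is replete if each fibre inclusion $\mathcal D_A\subset\mathcal E_A$ ($A\in\mathcal A$) is replete: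 each vertical isomorphism (isomorphism over an identity) of $\mathcal E_A$ with domain in $\mathcal D_A$ lies in $\mathcal D_A$. It is globally full if both $\mathcal D\subset\mathcal E$ and $\mathcal A\subset\mathcal B$ are full. It is a subfibration if $P$ and $\bar P$ are fibrations, and a strong subfibration if moreover the inclusion $\mathcal D\hookrightarrow\mathcal E$ sends $\bar P$-Cartesian arrows to $P$-Cartesian arrows. A subfunctor of trivial objects is a replete subfunctor $\mathrm{Triv}_t\to\mathrm{Triv}_b$ of $P$. An object $B\in\mathcal B$ is locally trivial in $K$ if it has a $K$-covering whose arrows all have domains in $\mathrm{Triv}_b$. An object $E\in\mathcal E$ is locally trivial in $K$ if there is a $K$-covering $R$ of $P(E)$ such that for each $f\in R$ there is a $P$-Cartesian arrow $T_f\to E$ over $f$ with $T_f\in\mathrm{Triv}_t$. $\mathrm{Loc}(K)\colon\mathrm{Loc}_t(K)\to\mathrm{Loc}_b(K)$ is the restriction of $P$ to the full subcategories of locally trivial objects of $\mathcal E$ and $\mathcal B$. $K_l$ is the covering function on $\mathrm{Loc}_b(K)$ whose coverings are the $K$-coverings all of whose arrows have domain in $\mathrm{Triv}_b$; $K'_l$ is defined likewise from $K'$ on $\mathrm{Loc}_b(K')$. In particular $K_l\preceq K'_l$ means that every $K$-covering with domains in $\mathrm{Triv}_b$ is refined by a $K'$-covering with domains in $\mathrm{Triv}_b$. *)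

theory Defs
  imports Main
begin

section \<open>Categories, subcategories, functors\<close>

record ('o, 'a) cat =
  Obj :: "'o set"
  Arr :: "'a set"
  Dom :: "'a \<Rightarrow> 'o"
  Cod :: "'a \<Rightarrow> 'o"
  Idt :: "'o \<Rightarrow> 'a"
  Cmp :: "'a \<Rightarrow> 'a \<Rightarrow> 'a"

text \<open>\<open>Cmp C g f\<close> is "g after f"; it is meaningful only if \<open>Dom C g = Cod C f\<close>.
  All operations are unconstrained outside the carriers.\<close>

locale category =
  fixes C :: "('o, 'a) cat"
  assumes Dom_Obj: "f \<in> Arr C \<Longrightarrow> Dom C f \<in> Obj C"
    and Cod_Obj: "f \<in> Arr C \<Longrightarrow> Cod C f \<in> Obj C"
    and Idt_Arr: "X \<in> Obj C \<Longrightarrow> Idt C X \<in> Arr C"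
    and Dom_Idt: "X \<in> Obj C \<Longrightarrow> Dom C (Idt C X) = X"
    and Cod_Idt: "X \<in> Obj C \<Longrightarrow> Cod C (Idt C X) = X"
    and Cmp_Arr: "\<lbrakk>g \<in> Arr C; f \<in> Arr C; Dom C g = Cod C f\<rbrakk> \<Longrightarrow> Cmp C g f \<in> Arr C"
    and Dom_Cmp: "\<lbrakk>g \<in> Arr C; f \<in> Arr C; Dom C g = Cod C f\<rbrakk> \<Longrightarrow> Dom C (Cmp C g f) = Dom C f"
    and Cod_Cmp: "\<lbrakk>g \<in> Arr C; f \<in> Arr C; Dom C g = Cod C f\<rbrakk> \<Longrightarrow> Cod C (Cmp C g f) = Cod C g"
    and Cmp_Idt: "f \<in> Arr C \<Longrightarrow> Cmp C f (Idt C (Dom C f)) = f"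
    and Idt_Cmp: "f \<in> Arr C \<Longrightarrow> Cmp C (Idt C (Cod C f)) f = f"
    and Cmp_assoc: "\<lbrakk>h \<in> Arr C; g \<in> Arr C; f \<in> Arr C; Dom C h = Cod C g; Dom C g = Cod C f\<rbrakk>
      \<Longrightarrow> Cmp C (Cmp C h g) f = Cmp C h (Cmp C g f)"

definition isomorphism :: "('o, 'a) cat \<Rightarrow> 'a \<Rightarrow> bool" where
  "isomorphism C f \<longleftrightarrow> f \<in> Arr C \<and>
     (\<exists>g\<in>Arr C. Dom C g = Cod C f \<and> Cod C g = Dom C f \<and>
        Cmp C g f = Idt C (Dom C f) \<and> Cmp C f g = Idt C (Cod C f))"

definition subcategory :: "('o, 'a) cat \<Rightarrow> ('o, 'a) cat \<Rightarrow> bool" where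
  "subcategory D C \<longleftrightarrow> category D \<and> category C \<and> Obj D \<subseteq> Obj C \<and> Arr D \<subseteq> Arr C \<and>
     (\<forall>f\<in>Arr D. Dom D f = Dom C f \<and> Cod D f = Cod C f) \<and>
     (\<forall>X\<in>Obj D. Idt D X = Idt C X) \<and>
     (\<forall>g\<in>Arr D. \<forall>f\<in>Arr D. Dom D g = Cod D f \<longrightarrow> Cmp D g f = Cmp C g f)"

definition full_in :: "('o, 'a) cat \<Rightarrow> ('o, 'a) cat \<Rightarrow> bool" where
  "full_in D C \<longleftrightarrow> (\<forall>f\<in>Arr C. Dom C f \<in> Obj D \<and> Cod C f \<in> Obj D \<longrightarrow> f \<in> Arr D)"

definition replete_in :: "('o, 'a) cat \<Rightarrow> ('o, 'a) cat \<Rightarrow> bool" where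
  "replete_in D C \<longleftrightarrow> (\<forall>f. isomorphism C f \<and> Dom C f \<in> Obj D \<longrightarrow> f \<in> Arr D)"

definition full_subcat :: "('o, 'a) cat \<Rightarrow> 'o set \<Rightarrow> ('o, 'a) cat" where
  "full_subcat C S = C\<lparr>Obj := Obj C \<inter> S, Arr := {f \<in> Arr C. Dom C f \<in> S \<and> Cod C f \<in> S}\<rparr>"

record ('oe, 'ae, 'ob, 'ab) func =
  Src :: "('oe, 'ae) cat"
  Tgt :: "('ob, 'ab) cat"
  OMap :: "'oe \<Rightarrow> 'ob"
  AMap :: "'ae \<Rightarrow> 'ab"

locale is_functor =
  fixes P :: "('oe, 'ae, 'ob, 'ab) func"
  assumes Src_category: "category (Src P)"
    and Tgt_category: "category (Tgt P)"
    and OMap_Obj: "X \<in> Obj (Src P) \<Longrightarrow> OMap P X \<in> Obj (Tgt P)"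
    and AMap_Arr: "f \<in> Arr (Src P) \<Longrightarrow> AMap P f \<in> Arr (Tgt P)"
    and Dom_AMap: "f \<in> Arr (Src P) \<Longrightarrow> Dom (Tgt P) (AMap P f) = OMap P (Dom (Src P) f)"
    and Cod_AMap: "f \<in> Arr (Src P) \<Longrightarrow> Cod (Tgt P) (AMap P f) = OMap P (Cod (Src P) f)"
    and AMap_Idt: "X \<in> Obj (Src P) \<Longrightarrow> AMap P (Idt (Src P) X) = Idt (Tgt P) (OMap P X)"
    and AMap_Cmp: "\<lbrakk>g \<in> Arr (Src P); f \<in> Arr (Src P); Dom (Src P) g = Cod (Src P) f\<rbrakk>
      \<Longrightarrow> AMap P (Cmp (Src P) g f) = Cmp (Tgt P) (AMap P g) (AMap P f)"

section \<open>Fibrations and subfibrations\<close>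

definition fibre :: "('oe, 'ae, 'ob, 'ab) func \<Rightarrow> 'ob \<Rightarrow> ('oe, 'ae) cat" where
  "fibre P A = (Src P)\<lparr>Obj := {X \<in> Obj (Src P). OMap P X = A},
                       Arr := {f \<in> Arr (Src P). AMap P f = Idt (Tgt P) A}\<rparr>"

definition cartesian :: "('oe, 'ae, 'ob, 'ab) func \<Rightarrow> 'ae \<Rightarrow> bool" where
  "cartesian P f \<longleftrightarrow> f \<in> Arr (Src P) \<and>
     (\<forall>g\<in>Arr (Src P). \<forall>u\<in>Arr (Tgt P).
        Cod (Src P) g = Cod (Src P) f \<and>
        Dom (Tgt P) u = OMap P (Dom (Src P) g) \<and> Cod (Tgt P) u = OMap P (Dom (Src P) f) \<and>
        Cmp (Tgt P) (AMap P f) u = AMap P g \<longrightarrow>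
        (\<exists>!h. h \<in> Arr (Src P) \<and> Dom (Src P) h = Dom (Src P) g \<and> Cod (Src P) h = Dom (Src P) f \<and>
           AMap P h = u \<and> Cmp (Src P) f h = g))"

definition fibration :: "('oe, 'ae, 'ob, 'ab) func \<Rightarrow> bool" where
  "fibration P \<longleftrightarrow> is_functor P \<and>
     (\<forall>X\<in>Obj (Src P). \<forall>f\<in>Arr (Tgt P). Cod (Tgt P) f = OMap P X \<longrightarrow>
        (\<exists>t. cartesian P t \<and> Cod (Src P) t = X \<and> AMap P t = f))"

definition subfunctor :: "('oe, 'ae, 'ob, 'ab) func \<Rightarrow> ('oe, 'ae, 'ob, 'ab) func \<Rightarrow> bool" where
  "subfunctor Q P \<longleftrightarrow> is_functor Q \<and> is_functor P \<and>
     subcategory (Src Q) (Src P) \<and> subcategory (Tgt Q) (Tgt P) \<and>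
     (\<forall>X\<in>Obj (Src Q). OMap Q X = OMap P X) \<and> (\<forall>f\<in>Arr (Src Q). AMap Q f = AMap P f)"

definition replete_subfunctor :: "('oe, 'ae, 'ob, 'ab) func \<Rightarrow> ('oe, 'ae, 'ob, 'ab) func \<Rightarrow> bool" where
  "replete_subfunctor Q P \<longleftrightarrow> subfunctor Q P \<and>
     (\<forall>A\<in>Obj (Tgt Q). replete_in (fibre Q A) (fibre P A))"

definition globally_full :: "('oe, 'ae, 'ob, 'ab) func \<Rightarrow> ('oe, 'ae, 'ob, 'ab) func \<Rightarrow> bool" where
  "globally_full Q P \<longleftrightarrow> subfunctor Q P \<and> full_in (Src Q) (Src P) \<and> full_in (Tgt Q) (Tgt P)"

definition subfibration :: "('oe, 'ae, 'ob, 'ab) func \<Rightarrow> ('oe, 'ae, 'ob, 'ab) func \<Rightarrow> bool" where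
  "subfibration Q P \<longleftrightarrow> subfunctor Q P \<and> fibration Q \<and> fibration P"

definition strong_subfibration :: "('oe, 'ae, 'ob, 'ab) func \<Rightarrow> ('oe, 'ae, 'ob, 'ab) func \<Rightarrow> bool" where
  "strong_subfibration Q P \<longleftrightarrow> subfibration Q P \<and> (\<forall>f. cartesian Q f \<longrightarrow> cartesian P f)"

section \<open>Covering functions\<close>

definition covering_of :: "('o, 'a) cat \<Rightarrow> 'o \<Rightarrow> 'a set \<Rightarrow> bool" where
  "covering_of C X R \<longleftrightarrow> (\<forall>f\<in>R. f \<in> Arr C \<and> Cod C f = X)"

definition covering_function :: "('o, 'a) cat \<Rightarrow> ('o \<Rightarrow> 'a set set) \<Rightarrow> bool" where
  "covering_function C K \<longleftrightarrow> (\<forall>X\<in>Obj C. \<forall>R\<in>K X. covering_of C X R)"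

definition refines :: "('o, 'a) cat \<Rightarrow> 'a set \<Rightarrow> 'a set \<Rightarrow> bool" where
  "refines C R S \<longleftrightarrow> (\<forall>f\<in>R. \<exists>g\<in>S. \<exists>h\<in>Arr C. Dom C g = Cod C h \<and> f = Cmp C g h)"

definition cov_le :: "('o, 'a) cat \<Rightarrow> ('o \<Rightarrow> 'a set set) \<Rightarrow> ('o \<Rightarrow> 'a set set) \<Rightarrow> bool" where
  "cov_le C K K' \<longleftrightarrow> (\<forall>X\<in>Obj C. \<forall>R\<in>K X. \<exists>S\<in>K' X. refines C S R)"

definition cov_equiv :: "('o, 'a) cat \<Rightarrow> ('o \<Rightarrow> 'a set set) \<Rightarrow> ('o \<Rightarrow> 'a set set) \<Rightarrow> bool" where
  "cov_equiv C K K' \<longleftrightarrow> cov_le C K K' \<and> cov_le C K' K"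

definition axiom_M_tilde :: "('o, 'a) cat \<Rightarrow> ('o \<Rightarrow> 'a set set) \<Rightarrow> bool" where
  "axiom_M_tilde C K \<longleftrightarrow> (\<forall>f. isomorphism C f \<longrightarrow> {f} \<in> K (Cod C f))"

definition coverage :: "('o, 'a) cat \<Rightarrow> ('o \<Rightarrow> 'a set set) \<Rightarrow> bool" where
  "coverage C K \<longleftrightarrow> covering_function C K \<and>
     (\<forall>X\<in>Obj C. \<forall>R\<in>K X. \<forall>g\<in>Arr C. Cod C g = X \<longrightarrow>
        (\<exists>S\<in>K (Dom C g). refines C (Cmp C g ` S) R))"

section \<open>Locally trivial objects\<close>

definition subfunctor_of_trivial_objects ::
    "('oe, 'ae, 'ob, 'ab) func \<Rightarrow> ('oe, 'ae, 'ob, 'ab) func \<Rightarrow> bool" where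
  "subfunctor_of_trivial_objects Triv P \<longleftrightarrow> replete_subfunctor Triv P"

definition Loc_b_objs ::
    "('oe, 'ae, 'ob, 'ab) func \<Rightarrow> ('oe, 'ae, 'ob, 'ab) func \<Rightarrow> ('ob \<Rightarrow> 'ab set set) \<Rightarrow> 'ob set" where
  "Loc_b_objs P Triv K = {X \<in> Obj (Tgt P). \<exists>R\<in>K X. \<forall>f\<in>R. Dom (Tgt P) f \<in> Obj (Tgt Triv)}"

definition Loc_t_objs ::
    "('oe, 'ae, 'ob, 'ab) func \<Rightarrow> ('oe, 'ae, 'ob, 'ab) func \<Rightarrow> ('ob \<Rightarrow> 'ab set set) \<Rightarrow> 'oe set" where
  "Loc_t_objs P Triv K = {E \<in> Obj (Src P). \<exists>R\<in>K (OMap P E). \<forall>f\<in>R.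
     \<exists>t. cartesian P t \<and> Cod (Src P) t = E \<and> AMap P t = f \<and> Dom (Src P) t \<in> Obj (Src Triv)}"

definition Loc ::
    "('oe, 'ae, 'ob, 'ab) func \<Rightarrow> ('oe, 'ae, 'ob, 'ab) func \<Rightarrow> ('ob \<Rightarrow> 'ab set set)
      \<Rightarrow> ('oe, 'ae, 'ob, 'ab) func" where
  "Loc P Triv K = P\<lparr>Src := full_subcat (Src P) (Loc_t_objs P Triv K),
                    Tgt := full_subcat (Tgt P) (Loc_b_objs P Triv K)\<rparr>"

text \<open>As a covering function on the base of \<open>Loc P Triv K\<close>. At an object of \<open>Tgt P\<close> that is not
  locally trivial in \<open>K\<close> the value is automatically empty, so \<open>loc_cov P Triv K\<close> and
  \<open>loc_cov P Triv K'\<close>, which live on two different full subcategories of \<open>Tgt P\<close>, can be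
  compared by \<open>cov_le (Tgt P)\<close>.\<close>

definition loc_cov ::
    "('oe, 'ae, 'ob, 'ab) func \<Rightarrow> ('oe, 'ae, 'ob, 'ab) func \<Rightarrow> ('ob \<Rightarrow> 'ab set set)
      \<Rightarrow> 'ob \<Rightarrow> 'ab set set" where
  "loc_cov P Triv K X = {R \<in> K X. \<forall>f\<in>R. Dom (Tgt P) f \<in> Obj (Tgt Triv)}"

end

theory Submission
  imports Defs
begin

text \<open>
  A trivialization of an object \<open>E\<close> is a covering \<open>R\<close> of \<open>P E\<close> together with Cartesian arrows into
  \<open>E\<close> over the members of \<open>R\<close>, with trivial domains. Everything rests on one observation:
  trivializations can be transported along refinements. If \<open>s = r h\<close> with \<open>h\<close> an arrow between
  objects of the base of trivial objects, then \<open>h\<close> is an arrow of that base by fullness, it has a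
  Cartesian lift ending at the trivial object over the domain of \<open>r\<close> because \<open>Triv\<close> is a fibration,
  that lift is Cartesian for \<open>P\<close> because the subfibration is strong, and its composite with the
  lift of \<open>r\<close> is a Cartesian arrow over \<open>s\<close> with trivial domain
  (\<open>trivial_lift_along_factorization\<close>). The comparison of coverings therefore carries local
  triviality from \<open>K\<close> to \<open>K'\<close>.

  For the second part, the coverage axiom makes local triviality stable under pullback. Given a
  Cartesian \<open>t : D \<rightarrow> E\<close> over \<open>g\<close>, a covering \<open>S\<close> of \<open>P D\<close> with \<open>g S\<close> refining a trivializing covering
  of \<open>E\<close> gives trivial Cartesian arrows into \<open>E\<close> over each \<open>g s\<close>. They factor through \<open>t\<close>, and by
  cancellation the factors are Cartesian arrows into \<open>D\<close> over \<open>s\<close>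
  (\<open>Loc_closed_under_cartesian\<close>). Hence \<open>Loc(K)\<close> is a full restriction of \<open>P\<close> that is closed
  under \<open>P\<close>-Cartesian lifts. Such a restriction is a fibration, and its Cartesian arrows are exactly
  those arrows of it that are \<open>P\<close>-Cartesian, since two Cartesian arrows over the same arrow with
  the same codomain differ by an isomorphism. The same holds for \<open>Loc(K')\<close>, which makes the
  inclusion between them a strong subfibration. Repleteness holds because isomorphisms are
  Cartesian, so that a trivialization can be composed with a vertical isomorphism.
\<close>

section \<open>Cartesian arrows\<close>

context is_functor
begin

lemma cartesian_Arr: "cartesian P f \<Longrightarrow> f \<in> Arr (Src P)"
  by (simp add: cartesian_def)

lemma cartesian_factor:
  assumes "cartesian P f" "g \<in> Arr (Src P)" "u \<in> Arr (Tgt P)"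
    and "Cod (Src P) g = Cod (Src P) f"
    and "Dom (Tgt P) u = OMap P (Dom (Src P) g)" "Cod (Tgt P) u = OMap P (Dom (Src P) f)"
    and "Cmp (Tgt P) (AMap P f) u = AMap P g"
  obtains h where "h \<in> Arr (Src P)" "Dom (Src P) h = Dom (Src P) g"
    "Cod (Src P) h = Dom (Src P) f" "AMap P h = u" "Cmp (Src P) f h = g"
  using assms unfolding cartesian_def by blast

lemma cartesian_unique:
  assumes f: "cartesian P f"
    and h: "h \<in> Arr (Src P)" "Cod (Src P) h = Dom (Src P) f"
    and k: "k \<in> Arr (Src P)" "Cod (Src P) k = Dom (Src P) f"
    and eq: "Dom (Src P) h = Dom (Src P) k" "AMap P h = AMap P k"
      "Cmp (Src P) f h = Cmp (Src P) f k"
  shows "h = k"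
proof -
  interpret E: category "Src P" by (rule Src_category)
  have fA: "f \<in> Arr (Src P)" using f by (rule cartesian_Arr)
  let ?g = "Cmp (Src P) f k" and ?u = "AMap P k"
  have "?g \<in> Arr (Src P)" "?u \<in> Arr (Tgt P)" "Cod (Src P) ?g = Cod (Src P) f"
    "Dom (Src P) ?g = Dom (Src P) k" "Dom (Tgt P) ?u = OMap P (Dom (Src P) k)"
    "Cod (Tgt P) ?u = OMap P (Dom (Src P) f)" "Cmp (Tgt P) (AMap P f) ?u = AMap P ?g"
    using fA k by (simp_all add: E.Cmp_Arr E.Cod_Cmp E.Dom_Cmp AMap_Arr Dom_AMap Cod_AMap AMap_Cmp)
  then have "\<exists>!x. x \<in> Arr (Src P) \<and> Dom (Src P) x = Dom (Src P) ?g \<and>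
      Cod (Src P) x = Dom (Src P) f \<and> AMap P x = ?u \<and> Cmp (Src P) f x = ?g"
    using f unfolding cartesian_def by metis
  then show ?thesis
    using h k eq \<open>Dom (Src P) ?g = Dom (Src P) k\<close> by metis
qed

lemma cartesianI:
  assumes f: "f \<in> Arr (Src P)"
    and ex: "\<And>g u. \<lbrakk>g \<in> Arr (Src P); u \<in> Arr (Tgt P); Cod (Src P) g = Cod (Src P) f;
        Dom (Tgt P) u = OMap P (Dom (Src P) g); Cod (Tgt P) u = OMap P (Dom (Src P) f);
        Cmp (Tgt P) (AMap P f) u = AMap P g\<rbrakk>
      \<Longrightarrow> \<exists>h \<in> Arr (Src P). Dom (Src P) h = Dom (Src P) g \<and> Cod (Src P) h = Dom (Src P) f \<and>
            AMap P h = u \<and> Cmp (Src P) f h = g"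
    and uniq: "\<And>h k. \<lbrakk>h \<in> Arr (Src P); k \<in> Arr (Src P); Cod (Src P) h = Dom (Src P) f;
        Cod (Src P) k = Dom (Src P) f; Dom (Src P) h = Dom (Src P) k; AMap P h = AMap P k;
        Cmp (Src P) f h = Cmp (Src P) f k\<rbrakk> \<Longrightarrow> h = k"
  shows "cartesian P f"
  unfolding cartesian_def
proof (intro conjI ballI impI f)
  fix g u
  assume g: "g \<in> Arr (Src P)" and u: "u \<in> Arr (Tgt P)"
    and c: "Cod (Src P) g = Cod (Src P) f \<and> Dom (Tgt P) u = OMap P (Dom (Src P) g) \<and>
      Cod (Tgt P) u = OMap P (Dom (Src P) f) \<and> Cmp (Tgt P) (AMap P f) u = AMap P g"
  obtain h where h: "h \<in> Arr (Src P)" "Dom (Src P) h = Dom (Src P) g"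
    "Cod (Src P) h = Dom (Src P) f" "AMap P h = u" "Cmp (Src P) f h = g"
    using ex[OF g u] c by blast
  show "\<exists>!h. h \<in> Arr (Src P) \<and> Dom (Src P) h = Dom (Src P) g \<and> Cod (Src P) h = Dom (Src P) f \<and>
      AMap P h = u \<and> Cmp (Src P) f h = g"
  proof (rule ex1I[of _ h])
    show "h \<in> Arr (Src P) \<and> Dom (Src P) h = Dom (Src P) g \<and> Cod (Src P) h = Dom (Src P) f \<and>
        AMap P h = u \<and> Cmp (Src P) f h = g"
      using h by simp
  next
    fix k assume k: "k \<in> Arr (Src P) \<and> Dom (Src P) k = Dom (Src P) g \<and>
      Cod (Src P) k = Dom (Src P) f \<and> AMap P k = u \<and> Cmp (Src P) f k = g"
    show "k = h" by (rule uniq) (use h k in simp_all)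
  qed
qed

lemma cartesian_Cmp:
  assumes f: "cartesian P f" and g: "cartesian P g" and fg: "Dom (Src P) f = Cod (Src P) g"
  shows "cartesian P (Cmp (Src P) f g)"
proof -
  interpret E: category "Src P" by (rule Src_category)
  interpret B: category "Tgt P" by (rule Tgt_category)
  note A = cartesian_Arr[OF f] cartesian_Arr[OF g]
  show ?thesis
  proof (rule cartesianI)
    show "Cmp (Src P) f g \<in> Arr (Src P)" using A fg by (simp add: E.Cmp_Arr)
  next
    fix x u
    assume x: "x \<in> Arr (Src P)" and u: "u \<in> Arr (Tgt P)"
      and cod: "Cod (Src P) x = Cod (Src P) (Cmp (Src P) f g)"
      and du: "Dom (Tgt P) u = OMap P (Dom (Src P) x)"
      and cu: "Cod (Tgt P) u = OMap P (Dom (Src P) (Cmp (Src P) f g))"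
      and eq: "Cmp (Tgt P) (AMap P (Cmp (Src P) f g)) u = AMap P x"
    let ?v = "Cmp (Tgt P) (AMap P g) u"
    have cu': "Cod (Tgt P) u = Dom (Tgt P) (AMap P g)"
      using A fg cu by (simp add: E.Dom_Cmp Dom_AMap)
    have v: "?v \<in> Arr (Tgt P)" "Dom (Tgt P) ?v = OMap P (Dom (Src P) x)"
      "Cod (Tgt P) ?v = OMap P (Dom (Src P) f)"
      using A fg u cu' du
      by (simp_all add: B.Cmp_Arr B.Dom_Cmp B.Cod_Cmp AMap_Arr Cod_AMap)
    have "Cmp (Tgt P) (AMap P f) ?v = AMap P x"
      using A fg u cu' eq
      by (simp add: AMap_Cmp B.Cmp_assoc AMap_Arr Dom_AMap Cod_AMap)
    moreover have "Cod (Src P) x = Cod (Src P) f"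
      using cod A fg by (simp add: E.Cod_Cmp)
    ultimately obtain y where y: "y \<in> Arr (Src P)" "Dom (Src P) y = Dom (Src P) x"
      "Cod (Src P) y = Dom (Src P) f" "AMap P y = ?v" "Cmp (Src P) f y = x"
      using cartesian_factor[OF f x v(1) _ v(2,3)] by metis
    have "Cod (Src P) y = Cod (Src P) g" using y fg by simp
    moreover have "Dom (Tgt P) u = OMap P (Dom (Src P) y)" using du y by simp
    moreover have "Cod (Tgt P) u = OMap P (Dom (Src P) g)" using cu' A by (simp add: Dom_AMap)
    moreover have "Cmp (Tgt P) (AMap P g) u = AMap P y" using y by simp
    ultimately obtain z where z: "z \<in> Arr (Src P)" "Dom (Src P) z = Dom (Src P) y"
      "Cod (Src P) z = Dom (Src P) g" "AMap P z = u" "Cmp (Src P) g z = y"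
      by (rule cartesian_factor[OF g y(1) u])
    then show "\<exists>h\<in>Arr (Src P). Dom (Src P) h = Dom (Src P) x \<and>
        Cod (Src P) h = Dom (Src P) (Cmp (Src P) f g) \<and> AMap P h = u \<and>
        Cmp (Src P) (Cmp (Src P) f g) h = x"
      using A fg y by (intro bexI[of _ z]) (simp_all add: E.Dom_Cmp E.Cmp_assoc)
  next
    fix h k
    assume hk: "h \<in> Arr (Src P)" "k \<in> Arr (Src P)"
      "Cod (Src P) h = Dom (Src P) (Cmp (Src P) f g)"
      "Cod (Src P) k = Dom (Src P) (Cmp (Src P) f g)"
      "Dom (Src P) h = Dom (Src P) k" "AMap P h = AMap P k"
      "Cmp (Src P) (Cmp (Src P) f g) h = Cmp (Src P) (Cmp (Src P) f g) k"
    have c: "Cod (Src P) h = Dom (Src P) g" "Cod (Src P) k = Dom (Src P) g"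
      using hk A fg by (simp_all add: E.Dom_Cmp)
    have "Cmp (Src P) g h = Cmp (Src P) g k"
    proof (rule cartesian_unique[OF f])
      show "Cmp (Src P) f (Cmp (Src P) g h) = Cmp (Src P) f (Cmp (Src P) g k)"
        using hk A fg c by (simp add: E.Cmp_assoc)
    qed (use hk A fg c in \<open>simp_all add: E.Cmp_Arr E.Cod_Cmp E.Dom_Cmp AMap_Cmp\<close>)
    then show "h = k"
      using cartesian_unique[OF g] hk c by blast
  qed
qed

text \<open>An arrow \<open>x\<close> into the codomain of \<open>v\<close> over \<open>P v \<circ> u\<close> factors through \<open>v\<close> because \<open>t x\<close> factors
  through \<open>t v\<close>; that the factorization is one of \<open>x\<close> itself, and not just of \<open>t x\<close>, is the
  uniqueness part for \<open>t\<close>.\<close>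

lemma cartesian_cancel:
  assumes t: "cartesian P t" and v: "v \<in> Arr (Src P)" and tv: "Dom (Src P) t = Cod (Src P) v"
    and comp: "cartesian P (Cmp (Src P) t v)"
  shows "cartesian P v"
proof -
  interpret E: category "Src P" by (rule Src_category)
  interpret B: category "Tgt P" by (rule Tgt_category)
  note A = cartesian_Arr[OF t] v
  let ?c = "Cmp (Src P) t v"
  have c: "?c \<in> Arr (Src P)" "Dom (Src P) ?c = Dom (Src P) v" "Cod (Src P) ?c = Cod (Src P) t"
    using A tv by (simp_all add: E.Cmp_Arr E.Dom_Cmp E.Cod_Cmp)
  show ?thesis
  proof (rule cartesianI[OF v])
    fix x u
    assume x: "x \<in> Arr (Src P)" and u: "u \<in> Arr (Tgt P)"
      and cod: "Cod (Src P) x = Cod (Src P) v"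
      and du: "Dom (Tgt P) u = OMap P (Dom (Src P) x)"
      and cu: "Cod (Tgt P) u = OMap P (Dom (Src P) v)"
      and eq: "Cmp (Tgt P) (AMap P v) u = AMap P x"
    let ?y = "Cmp (Src P) t x"
    have y: "?y \<in> Arr (Src P)" "Cod (Src P) ?y = Cod (Src P) ?c"
      "Dom (Tgt P) u = OMap P (Dom (Src P) ?y)" "Cod (Tgt P) u = OMap P (Dom (Src P) ?c)"
      using A tv x cod du cu c by (simp_all add: E.Cmp_Arr E.Dom_Cmp E.Cod_Cmp)
    have "Cmp (Tgt P) (AMap P ?c) u = AMap P ?y"
      using A tv x u cod cu eq
      by (simp add: AMap_Cmp B.Cmp_assoc AMap_Arr Dom_AMap Cod_AMap)
    then obtain z where z: "z \<in> Arr (Src P)" "Dom (Src P) z = Dom (Src P) ?y"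
      "Cod (Src P) z = Dom (Src P) ?c" "AMap P z = u" "Cmp (Src P) ?c z = ?y"
      by (rule cartesian_factor[OF comp y(1) u y(2,3,4)])
    have zd: "Dom (Src P) z = Dom (Src P) x" "Cod (Src P) z = Dom (Src P) v"
      using z A tv x cod c by (simp_all add: E.Dom_Cmp)
    have "Cmp (Src P) v z = x"
    proof (rule cartesian_unique[OF t])
      show "Cmp (Src P) t (Cmp (Src P) v z) = Cmp (Src P) t x"
        using z zd A tv by (simp add: E.Cmp_assoc)
      show "AMap P (Cmp (Src P) v z) = AMap P x"
        using z zd A eq by (simp add: AMap_Cmp)
    qed (use z zd A tv x cod in \<open>simp_all add: E.Cmp_Arr E.Dom_Cmp E.Cod_Cmp\<close>)
    then show "\<exists>h\<in>Arr (Src P). Dom (Src P) h = Dom (Src P) x \<and> Cod (Src P) h = Dom (Src P) v \<and>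
        AMap P h = u \<and> Cmp (Src P) v h = x"
      using z zd by blast
  next
    fix h k
    assume hk: "h \<in> Arr (Src P)" "k \<in> Arr (Src P)"
      "Cod (Src P) h = Dom (Src P) v" "Cod (Src P) k = Dom (Src P) v"
      "Dom (Src P) h = Dom (Src P) k" "AMap P h = AMap P k"
      "Cmp (Src P) v h = Cmp (Src P) v k"
    then have "Cmp (Src P) ?c h = Cmp (Src P) ?c k"
      using A tv by (simp add: E.Cmp_assoc)
    then show "h = k"
      using cartesian_unique[OF comp] hk c by metis
  qed
qed

text \<open>The factorization of \<open>g\<close> through \<open>i\<close> is \<open>j g\<close> for the inverse \<open>j\<close> of \<open>i\<close>. It lies over the
  prescribed \<open>u\<close> because \<open>P j\<close> is inverse to \<open>P i\<close>.\<close>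

lemma isomorphism_cartesian:
  assumes iso: "isomorphism (Src P) i"
  shows "cartesian P i"
proof -
  interpret E: category "Src P" by (rule Src_category)
  interpret B: category "Tgt P" by (rule Tgt_category)
  obtain j where i: "i \<in> Arr (Src P)" and j: "j \<in> Arr (Src P)"
    "Dom (Src P) j = Cod (Src P) i" "Cod (Src P) j = Dom (Src P) i"
    and ji: "Cmp (Src P) j i = Idt (Src P) (Dom (Src P) i)"
    and ij: "Cmp (Src P) i j = Idt (Src P) (Cod (Src P) i)"
    using iso unfolding isomorphism_def by blast
  have Pji: "Cmp (Tgt P) (AMap P j) (AMap P i) = Idt (Tgt P) (OMap P (Dom (Src P) i))"
    using i j ji by (metis AMap_Cmp AMap_Idt E.Dom_Obj)
  show ?thesis
  proof (rule cartesianI[OF i])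
    fix g u
    assume g: "g \<in> Arr (Src P)" and u: "u \<in> Arr (Tgt P)" and cod: "Cod (Src P) g = Cod (Src P) i"
      and cu: "Cod (Tgt P) u = OMap P (Dom (Src P) i)"
      and eq: "Cmp (Tgt P) (AMap P i) u = AMap P g"
    have "AMap P (Cmp (Src P) j g) = Cmp (Tgt P) (AMap P j) (Cmp (Tgt P) (AMap P i) u)"
      using g j cod eq by (simp add: AMap_Cmp)
    also have "\<dots> = Cmp (Tgt P) (Cmp (Tgt P) (AMap P j) (AMap P i)) u"
      using i j u cu by (simp add: B.Cmp_assoc AMap_Arr Dom_AMap Cod_AMap)
    also have "\<dots> = u"
      using Pji u cu B.Idt_Cmp[of u] by simp
    finally have "AMap P (Cmp (Src P) j g) = u" .
    moreover have "Cmp (Src P) i (Cmp (Src P) j g) = g"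
    proof -
      have "Cmp (Src P) i (Cmp (Src P) j g) = Cmp (Src P) (Cmp (Src P) i j) g"
        using i j g cod by (simp add: E.Cmp_assoc)
      then show ?thesis using ij g cod E.Idt_Cmp[of g] by simp
    qed
    ultimately show "\<exists>h\<in>Arr (Src P). Dom (Src P) h = Dom (Src P) g \<and>
        Cod (Src P) h = Dom (Src P) i \<and> AMap P h = u \<and> Cmp (Src P) i h = g"
      using g j cod
      by (intro bexI[of _ "Cmp (Src P) j g"]) (simp_all add: E.Cmp_Arr E.Dom_Cmp E.Cod_Cmp)
  next
    fix h k
    assume hk: "h \<in> Arr (Src P)" "k \<in> Arr (Src P)" "Cod (Src P) h = Dom (Src P) i"
      "Cod (Src P) k = Dom (Src P) i" "Cmp (Src P) i h = Cmp (Src P) i k"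
    have "Cmp (Src P) (Cmp (Src P) j i) h = Cmp (Src P) (Cmp (Src P) j i) k"
      using hk i j by (simp add: E.Cmp_assoc)
    then show "h = k"
      using ji hk E.Idt_Cmp[of h] E.Idt_Cmp[of k] by simp
  qed
qed

text \<open>Factoring each of the two arrows through the other over the identity gives mutually inverse
  comparison arrows.\<close>

lemma cartesian_iso_unique:
  assumes f: "cartesian P f" and t: "cartesian P t"
    and cod: "Cod (Src P) f = Cod (Src P) t" and over: "AMap P f = AMap P t"
  obtains i where "isomorphism (Src P) i" "Dom (Src P) i = Dom (Src P) f"
    "Cod (Src P) i = Dom (Src P) t" "f = Cmp (Src P) t i"
proof -
  interpret E: category "Src P" by (rule Src_category)
  interpret B: category "Tgt P" by (rule Tgt_category)
  have comparison: "\<exists>i\<in>Arr (Src P). Dom (Src P) i = Dom (Src P) a \<and> Cod (Src P) i = Dom (Src P) b \<and>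
      AMap P i = Idt (Tgt P) (OMap P (Dom (Src P) b)) \<and> Cmp (Src P) b i = a"
    if a: "cartesian P a" and b: "cartesian P b"
      and c: "Cod (Src P) a = Cod (Src P) b" and o: "AMap P a = AMap P b" for a b
  proof -
    note A = cartesian_Arr[OF a] cartesian_Arr[OF b]
    have same: "OMap P (Dom (Src P) a) = OMap P (Dom (Src P) b)"
      using o Dom_AMap A by metis
    let ?u = "Idt (Tgt P) (OMap P (Dom (Src P) b))"
    have D: "OMap P (Dom (Src P) b) \<in> Obj (Tgt P)"
      using A by (simp add: OMap_Obj E.Dom_Obj)
    have "Cmp (Tgt P) (AMap P b) ?u = AMap P a"
      using B.Cmp_Idt[of "AMap P b"] A o by (simp add: AMap_Arr Dom_AMap)
    then show ?thesis
      using cartesian_factor[OF b A(1) B.Idt_Arr[OF D] c] same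
        B.Dom_Idt[OF D] B.Cod_Idt[OF D] by metis
  qed
  note A = cartesian_Arr[OF f] cartesian_Arr[OF t]
  obtain i where i: "i \<in> Arr (Src P)" "Dom (Src P) i = Dom (Src P) f"
    "Cod (Src P) i = Dom (Src P) t" "AMap P i = Idt (Tgt P) (OMap P (Dom (Src P) t))"
    "Cmp (Src P) t i = f"
    using comparison[OF f t cod over] by blast
  obtain j where j: "j \<in> Arr (Src P)" "Dom (Src P) j = Dom (Src P) t"
    "Cod (Src P) j = Dom (Src P) f" "AMap P j = Idt (Tgt P) (OMap P (Dom (Src P) f))"
    "Cmp (Src P) f j = t"
    using comparison[OF t f cod[symmetric] over[symmetric]] by blast
  have inverse: "Cmp (Src P) l k = Idt (Src P) (Dom (Src P) a)"
    if a: "cartesian P a" and ab: "OMap P (Dom (Src P) a) = OMap P (Dom (Src P) b)"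
      and k: "k \<in> Arr (Src P)" "Dom (Src P) k = Dom (Src P) a" "Cod (Src P) k = Dom (Src P) b"
        "AMap P k = Idt (Tgt P) (OMap P (Dom (Src P) b))"
      and l: "l \<in> Arr (Src P)" "Dom (Src P) l = Dom (Src P) b" "Cod (Src P) l = Dom (Src P) a"
        "AMap P l = Idt (Tgt P) (OMap P (Dom (Src P) a))"
      and al: "Cmp (Src P) a l = b" and bk: "Cmp (Src P) b k = a" for a b k l
  proof (rule cartesian_unique[OF a])
    note aA = cartesian_Arr[OF a]
    have O: "Dom (Src P) a \<in> Obj (Src P)" using aA by (rule E.Dom_Obj)
    have "Cmp (Src P) a (Cmp (Src P) l k) = Cmp (Src P) (Cmp (Src P) a l) k"
      using E.Cmp_assoc[OF aA l(1) k(1)] k(3) l(2,3) by simp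
    then show "Cmp (Src P) a (Cmp (Src P) l k) = Cmp (Src P) a (Idt (Src P) (Dom (Src P) a))"
      unfolding al bk E.Cmp_Idt[OF aA] .
    have I: "OMap P (Dom (Src P) a) \<in> Obj (Tgt P)" using O by (rule OMap_Obj)
    show "AMap P (Cmp (Src P) l k) = AMap P (Idt (Src P) (Dom (Src P) a))"
      using AMap_Cmp[OF l(1) k(1)] k(3,4) l(2,4) ab AMap_Idt[OF O]
        B.Cmp_Idt[OF B.Idt_Arr[OF I]] B.Dom_Idt[OF I] by simp
    show "Cmp (Src P) l k \<in> Arr (Src P)" "Cod (Src P) (Cmp (Src P) l k) = Dom (Src P) a"
      using k l by (simp_all add: E.Cmp_Arr E.Cod_Cmp)
    show "Idt (Src P) (Dom (Src P) a) \<in> Arr (Src P)"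
      "Cod (Src P) (Idt (Src P) (Dom (Src P) a)) = Dom (Src P) a"
      using O by (simp_all add: E.Idt_Arr E.Cod_Idt)
    show "Dom (Src P) (Cmp (Src P) l k) = Dom (Src P) (Idt (Src P) (Dom (Src P) a))"
      using E.Dom_Cmp[OF l(1) k(1)] k l O by (simp add: E.Dom_Idt)
  qed
  have same: "OMap P (Dom (Src P) f) = OMap P (Dom (Src P) t)"
    using over Dom_AMap A by metis
  have "Cmp (Src P) j i = Idt (Src P) (Dom (Src P) f)"
    by (rule inverse[OF f same i(1-4) j(1-4) j(5) i(5)])
  moreover have "Cmp (Src P) i j = Idt (Src P) (Dom (Src P) t)"
    by (rule inverse[OF t same[symmetric] j(1-4) i(1-4) i(5) j(5)])
  ultimately have "isomorphism (Src P) i"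
    unfolding isomorphism_def using i j by metis
  then show thesis using that i by metis
qed

end

section \<open>Full restrictions of fibrations\<close>

lemma full_subcat_sel [simp]:
  "Obj (full_subcat C S) = Obj C \<inter> S"
  "Arr (full_subcat C S) = {f \<in> Arr C. Dom C f \<in> S \<and> Cod C f \<in> S}"
  "Dom (full_subcat C S) = Dom C" "Cod (full_subcat C S) = Cod C"
  "Idt (full_subcat C S) = Idt C" "Cmp (full_subcat C S) = Cmp C"
  by (simp_all add: full_subcat_def)

lemma category_full_subcat:
  assumes "category C"
  shows "category (full_subcat C S)"
proof -
  interpret C: category C by fact
  show ?thesis
    by standard (auto simp: C.Dom_Obj C.Cod_Obj C.Idt_Arr C.Dom_Idt C.Cod_Idt C.Cmp_Arr C.Dom_Cmp
        C.Cod_Cmp C.Cmp_Idt C.Idt_Cmp C.Cmp_assoc)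
qed

lemma subcategory_full_subcat:
  assumes "category C" "S \<subseteq> S'"
  shows "subcategory (full_subcat C S) (full_subcat C S')"
  using assms by (auto simp: subcategory_def category_full_subcat)

lemma isomorphism_full_subcat:
  "isomorphism (full_subcat C S) f \<Longrightarrow> isomorphism C f"
  by (auto simp: isomorphism_def)

definition full_restriction ::
    "('oe, 'ae, 'ob, 'ab) func \<Rightarrow> 'oe set \<Rightarrow> 'ob set \<Rightarrow> ('oe, 'ae, 'ob, 'ab) func" where
  "full_restriction P S T = P\<lparr>Src := full_subcat (Src P) S, Tgt := full_subcat (Tgt P) T\<rparr>"

lemma full_restriction_sel [simp]:
  "Src (full_restriction P S T) = full_subcat (Src P) S"
  "Tgt (full_restriction P S T) = full_subcat (Tgt P) T"
  "OMap (full_restriction P S T) = OMap P" "AMap (full_restriction P S T) = AMap P"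
  by (simp_all add: full_restriction_def)

context is_functor
begin

lemma is_functor_full_restriction:
  assumes "\<And>X. X \<in> Obj (Src P) \<Longrightarrow> X \<in> S \<Longrightarrow> OMap P X \<in> T"
  shows "is_functor (full_restriction P S T)"
proof -
  interpret E: category "Src P" by (rule Src_category)
  show ?thesis
    using assms
    by (intro is_functor.intro)
      (auto simp: category_full_subcat Src_category Tgt_category OMap_Obj AMap_Arr Dom_AMap
        Cod_AMap AMap_Idt AMap_Cmp E.Dom_Obj E.Cod_Obj)
qed

lemma cartesian_full_restriction:
  assumes f: "cartesian P f" and "Dom (Src P) f \<in> S" "Cod (Src P) f \<in> S"
  shows "cartesian (full_restriction P S T) f"
  unfolding cartesian_def
proof (intro conjI ballI impI)
  show "f \<in> Arr (Src (full_restriction P S T))"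
    using assms cartesian_Arr by simp
next
  fix g u
  assume g: "g \<in> Arr (Src (full_restriction P S T))" "u \<in> Arr (Tgt (full_restriction P S T))"
    and "Cod (Src (full_restriction P S T)) g = Cod (Src (full_restriction P S T)) f \<and>
      Dom (Tgt (full_restriction P S T)) u =
        OMap (full_restriction P S T) (Dom (Src (full_restriction P S T)) g) \<and>
      Cod (Tgt (full_restriction P S T)) u =
        OMap (full_restriction P S T) (Dom (Src (full_restriction P S T)) f) \<and>
      Cmp (Tgt (full_restriction P S T)) (AMap (full_restriction P S T) f) u =
        AMap (full_restriction P S T) g"
  then have "\<exists>!h. h \<in> Arr (Src P) \<and> Dom (Src P) h = Dom (Src P) g \<and>
      Cod (Src P) h = Dom (Src P) f \<and> AMap P h = u \<and> Cmp (Src P) f h = g"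
    using f unfolding cartesian_def by simp
  moreover have "(h \<in> Arr (Src P) \<and> Dom (Src P) h = Dom (Src P) g \<and>
      Cod (Src P) h = Dom (Src P) f \<and> AMap P h = u \<and> Cmp (Src P) f h = g) \<longleftrightarrow>
      (h \<in> Arr (full_subcat (Src P) S) \<and> Dom (Src P) h = Dom (Src P) g \<and>
      Cod (Src P) h = Dom (Src P) f \<and> AMap P h = u \<and> Cmp (Src P) f h = g)" for h
    using g assms by auto
  ultimately show "\<exists>!h. h \<in> Arr (Src (full_restriction P S T)) \<and>
      Dom (Src (full_restriction P S T)) h = Dom (Src (full_restriction P S T)) g \<and>
      Cod (Src (full_restriction P S T)) h = Dom (Src (full_restriction P S T)) f \<and>
      AMap (full_restriction P S T) h = u \<and> Cmp (Src (full_restriction P S T)) f h = g"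
    by (simp only: full_restriction_sel full_subcat_sel(3,4,5,6))
qed

end

text \<open>Pullback stability of the chosen objects. It is demanded of every Cartesian arrow, which avoids
  fixing a choice of lifts.\<close>

definition closed_under_cartesian ::
    "('oe, 'ae, 'ob, 'ab) func \<Rightarrow> 'oe set \<Rightarrow> 'ob set \<Rightarrow> bool" where
  "closed_under_cartesian P S T \<longleftrightarrow>
     (\<forall>t. cartesian P t \<and> Cod (Src P) t \<in> S \<and> OMap P (Dom (Src P) t) \<in> T \<longrightarrow> Dom (Src P) t \<in> S)"

lemma cartesian_lift_in_full_restriction:
  assumes P: "fibration P" and closed: "closed_under_cartesian P S T"
    and X: "X \<in> Obj (Src P)" "X \<in> S"
    and f: "f \<in> Arr (Tgt P)" "Dom (Tgt P) f \<in> T" "Cod (Tgt P) f = OMap P X"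
  obtains t where "cartesian P t" "cartesian (full_restriction P S T) t"
    "Cod (Src P) t = X" "AMap P t = f"
proof -
  interpret is_functor P using P by (simp add: fibration_def)
  obtain t where t: "cartesian P t" "Cod (Src P) t = X" "AMap P t = f"
    using P X f unfolding fibration_def by blast
  have "OMap P (Dom (Src P) t) \<in> T"
    using f t Dom_AMap[OF cartesian_Arr[OF t(1)]] by simp
  then have "Dom (Src P) t \<in> S"
    using closed t X unfolding closed_under_cartesian_def by blast
  then show thesis
    using that t X cartesian_full_restriction[OF t(1)] by blast
qed

lemma fibration_full_restriction:
  assumes P: "fibration P" and maps: "\<And>X. X \<in> Obj (Src P) \<Longrightarrow> X \<in> S \<Longrightarrow> OMap P X \<in> T"
    and closed: "closed_under_cartesian P S T"
  shows "fibration (full_restriction P S T)"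
proof -
  interpret is_functor P using P by (simp add: fibration_def)
  show ?thesis
    unfolding fibration_def
  proof (intro conjI ballI impI is_functor_full_restriction maps)
    fix X f
    assume "X \<in> Obj (Src (full_restriction P S T))" "f \<in> Arr (Tgt (full_restriction P S T))"
      "Cod (Tgt (full_restriction P S T)) f = OMap (full_restriction P S T) X"
    then show "\<exists>t. cartesian (full_restriction P S T) t \<and>
        Cod (Src (full_restriction P S T)) t = X \<and> AMap (full_restriction P S T) t = f"
      using cartesian_lift_in_full_restriction[OF P closed, of X f] by auto
  qed
qed

text \<open>An arrow that is Cartesian for the restriction is isomorphic, inside the restriction, to a
  \<open>P\<close>-Cartesian arrow over the same arrow.\<close>

lemma cartesian_of_cartesian_full_restriction:
  assumes P: "fibration P" and maps: "\<And>X. X \<in> Obj (Src P) \<Longrightarrow> X \<in> S \<Longrightarrow> OMap P X \<in> T"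
    and closed: "closed_under_cartesian P S T"
    and f: "cartesian (full_restriction P S T) f"
  shows "cartesian P f"
proof -
  interpret is_functor P using P by (simp add: fibration_def)
  interpret E: category "Src P" by (rule Src_category)
  interpret Q: is_functor "full_restriction P S T"
    using maps by (rule is_functor_full_restriction)
  have fA: "f \<in> Arr (Src P)" "Dom (Src P) f \<in> S" "Cod (Src P) f \<in> S"
    using Q.cartesian_Arr[OF f] by simp_all
  have "Dom (Tgt P) (AMap P f) \<in> T"
    using fA maps by (simp add: Dom_AMap E.Dom_Obj)
  then obtain t where t: "cartesian P t" "cartesian (full_restriction P S T) t"
    "Cod (Src P) t = Cod (Src P) f" "AMap P t = AMap P f"
    using cartesian_lift_in_full_restriction[OF P closed, of "Cod (Src P) f" "AMap P f"] fA
    by (auto simp: E.Cod_Obj AMap_Arr Cod_AMap)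
  obtain i where i: "isomorphism (full_subcat (Src P) S) i" "Cod (Src P) i = Dom (Src P) t"
    "f = Cmp (Src P) t i"
    using Q.cartesian_iso_unique[OF f t(2)] t(3,4) by auto
  show ?thesis
    unfolding i(3)
    using cartesian_Cmp[OF t(1) isomorphism_cartesian[OF isomorphism_full_subcat[OF i(1)]]] i(2)
    by simp
qed

lemma globally_full_full_restriction:
  assumes P: "is_functor P"
    and maps: "\<And>X. X \<in> Obj (Src P) \<Longrightarrow> X \<in> S \<Longrightarrow> OMap P X \<in> T"
    and maps': "\<And>X. X \<in> Obj (Src P) \<Longrightarrow> X \<in> S' \<Longrightarrow> OMap P X \<in> T'"
    and sub: "S \<subseteq> S'" "T \<subseteq> T'"
  shows "globally_full (full_restriction P S T) (full_restriction P S' T')"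
proof -
  interpret is_functor P by fact
  show ?thesis
    using is_functor_full_restriction[of S T, OF maps] is_functor_full_restriction[of S' T', OF maps']
      subcategory_full_subcat[OF Src_category sub(1)] subcategory_full_subcat[OF Tgt_category sub(2)]
    by (auto simp: globally_full_def subfunctor_def full_in_def)
qed

lemma strong_subfibration_full_restriction:
  assumes P: "fibration P"
    and maps: "\<And>X. X \<in> Obj (Src P) \<Longrightarrow> X \<in> S \<Longrightarrow> OMap P X \<in> T"
    and maps': "\<And>X. X \<in> Obj (Src P) \<Longrightarrow> X \<in> S' \<Longrightarrow> OMap P X \<in> T'"
    and closed: "closed_under_cartesian P S T" and closed': "closed_under_cartesian P S' T'"
    and sub: "S \<subseteq> S'" "T \<subseteq> T'"
  shows "strong_subfibration (full_restriction P S T) (full_restriction P S' T')"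
  unfolding strong_subfibration_def subfibration_def
proof (intro conjI allI impI)
  interpret is_functor P using P by (simp add: fibration_def)
  show "subfunctor (full_restriction P S T) (full_restriction P S' T')"
    using globally_full_full_restriction[OF is_functor_axioms maps maps' sub]
    by (simp add: globally_full_def)
  show "fibration (full_restriction P S T)" "fibration (full_restriction P S' T')"
    using fibration_full_restriction[OF P] maps maps' closed closed' by blast+
  fix f assume f: "cartesian (full_restriction P S T) f"
  then have "Dom (Src P) f \<in> S'" "Cod (Src P) f \<in> S'"
    using sub by (auto simp: cartesian_def)
  moreover have "cartesian P f"
    using cartesian_of_cartesian_full_restriction[OF P maps closed f] by blast
  ultimately show "cartesian (full_restriction P S' T') f"
    by (simp add: cartesian_full_restriction)
qed

lemma fibre_isomorphism:
  assumes P: "is_functor P" and A: "A \<in> Obj (Tgt P)" and iso: "isomorphism (fibre P A) f"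
  shows "isomorphism (Src P) f" "AMap P f = Idt (Tgt P) A"
    "OMap P (Dom (Src P) f) = A" "OMap P (Cod (Src P) f) = A"
proof -
  interpret is_functor P by fact
  interpret B: category "Tgt P" by (rule Tgt_category)
  show "isomorphism (Src P) f" "AMap P f = Idt (Tgt P) A"
    using iso by (auto simp: isomorphism_def fibre_def)
  then show "OMap P (Dom (Src P) f) = A" "OMap P (Cod (Src P) f) = A"
    using A Dom_AMap[of f] Cod_AMap[of f]
    by (auto simp: isomorphism_def B.Dom_Idt B.Cod_Idt)
qed

section \<open>Transport of trivializations\<close>

lemma Loc_full_restriction:
  "Loc P Triv K = full_restriction P (Loc_t_objs P Triv K) (Loc_b_objs P Triv K)"
  by (simp add: Loc_def full_restriction_def)

definition has_trivial_lift ::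
    "('oe, 'ae, 'ob, 'ab) func \<Rightarrow> ('oe, 'ae, 'ob, 'ab) func \<Rightarrow> 'oe \<Rightarrow> 'ab \<Rightarrow> bool" where
  "has_trivial_lift P Triv E f \<longleftrightarrow> (\<exists>t. cartesian P t \<and> Cod (Src P) t = E \<and> AMap P t = f \<and>
     Dom (Src P) t \<in> Obj (Src Triv))"

lemma has_trivial_liftI:
  "\<lbrakk>cartesian P t; Cod (Src P) t = E; AMap P t = f; Dom (Src P) t \<in> Obj (Src Triv)\<rbrakk>
    \<Longrightarrow> has_trivial_lift P Triv E f"
  unfolding has_trivial_lift_def by (intro exI[of _ t] conjI)

lemma has_trivial_liftE:
  assumes "has_trivial_lift P Triv E f"
  obtains t where "cartesian P t" "Cod (Src P) t = E" "AMap P t = f"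
    "Dom (Src P) t \<in> Obj (Src Triv)"
  using assms unfolding has_trivial_lift_def by (elim exE conjE)

lemma Loc_t_objs_iff:
  "E \<in> Loc_t_objs P Triv K \<longleftrightarrow>
     E \<in> Obj (Src P) \<and> (\<exists>R\<in>K (OMap P E). \<forall>f\<in>R. has_trivial_lift P Triv E f)"
  by (simp add: Loc_t_objs_def has_trivial_lift_def)

text \<open>The base of a trivial object is trivial, so a covering that trivializes an object of the total
  category automatically has trivial domains and may be compared with coverings for \<open>K'\<close>.\<close>

lemma loc_cov_trivializing:
  assumes P: "is_functor P" and Triv: "subfunctor Triv P"
    and R: "R \<in> K X"
    and triv: "\<forall>f\<in>R. has_trivial_lift P Triv E f"
  shows "R \<in> loc_cov P Triv K X"
proof -
  interpret is_functor P by fact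
  have "Dom (Tgt P) f \<in> Obj (Tgt Triv)" if "f \<in> R" for f
  proof -
    obtain t where t: "cartesian P t" "AMap P t = f" "Dom (Src P) t \<in> Obj (Src Triv)"
      using triv \<open>f \<in> R\<close> by (blast elim: has_trivial_liftE)
    have "OMap Triv (Dom (Src P) t) \<in> Obj (Tgt Triv)"
      using Triv is_functor.OMap_Obj[OF _ t(3)] by (simp add: subfunctor_def)
    then show ?thesis
      using t Triv Dom_AMap[OF cartesian_Arr[OF t(1)]] by (simp add: subfunctor_def)
  qed
  then show ?thesis using R by (simp add: loc_cov_def)
qed

lemma OMap_Loc_t_objs:
  assumes "is_functor P" "subfunctor Triv P" "E \<in> Loc_t_objs P Triv K"
  shows "OMap P E \<in> Loc_b_objs P Triv K"
proof -
  obtain R where "E \<in> Obj (Src P)" "R \<in> loc_cov P Triv K (OMap P E)"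
    using assms(3) loc_cov_trivializing[OF assms(1,2)] unfolding Loc_t_objs_iff by blast
  then show ?thesis
    using is_functor.OMap_Obj[OF assms(1)] by (auto simp: Loc_b_objs_def loc_cov_def)
qed

text \<open>Fullness on the base puts \<open>h\<close> into the base of \<open>Triv\<close>, the fibration \<open>Triv\<close> supplies a lift
  \<open>l\<close> of \<open>h\<close> ending at the domain of \<open>t\<close>, and strongness makes \<open>l\<close> Cartesian for \<open>P\<close>, so that \<open>t l\<close> is the required lift.\<close>

lemma trivial_lift_along_factorization:
  assumes P: "is_functor P" and gf: "globally_full Triv P" and st: "strong_subfibration Triv P"
    and t: "cartesian P t" "Dom (Src P) t \<in> Obj (Src Triv)"
    and h: "h \<in> Arr (Tgt P)" "Cod (Tgt P) h = Dom (Tgt P) (AMap P t)"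
      "Dom (Tgt P) h \<in> Obj (Tgt Triv)"
  shows "has_trivial_lift P Triv (Cod (Src P) t) (Cmp (Tgt P) (AMap P t) h)"
proof -
  interpret is_functor P by fact
  interpret E: category "Src P" by (rule Src_category)
  have sub: "subfunctor Triv P" using gf by (simp add: globally_full_def)
  interpret T: is_functor Triv using sub by (simp add: subfunctor_def)
  interpret TE: category "Src Triv" by (rule T.Src_category)
  note tA = cartesian_Arr[OF t(1)]
  have ch: "Cod (Tgt P) h = OMap Triv (Dom (Src P) t)"
    using h tA t sub by (simp add: Dom_AMap subfunctor_def)
  then have hA: "h \<in> Arr (Tgt Triv)"
    using h gf T.OMap_Obj[OF t(2)] by (auto simp: globally_full_def full_in_def)
  then have "Cod (Tgt Triv) h = OMap Triv (Dom (Src P) t)"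
    using ch sub by (simp add: subfunctor_def subcategory_def)
  then obtain l where l: "cartesian Triv l" "Cod (Src Triv) l = Dom (Src P) t" "AMap Triv l = h"
    using st hA t(2) unfolding strong_subfibration_def subfibration_def fibration_def by blast
  have lA: "l \<in> Arr (Src Triv)" using l by (simp add: cartesian_def)
  have lP: "cartesian P l" using st l by (simp add: strong_subfibration_def)
  have eqs: "Cod (Src P) l = Dom (Src P) t" "Dom (Src P) l = Dom (Src Triv) l" "AMap P l = h"
    using sub lA l by (simp_all add: subfunctor_def subcategory_def)
  have "cartesian P (Cmp (Src P) t l)"
    using cartesian_Cmp[OF t(1) lP] eqs by simp
  moreover have "Cod (Src P) (Cmp (Src P) t l) = Cod (Src P) t"
    "AMap P (Cmp (Src P) t l) = Cmp (Tgt P) (AMap P t) h"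
    "Dom (Src P) (Cmp (Src P) t l) \<in> Obj (Src Triv)"
    using tA cartesian_Arr[OF lP] eqs TE.Dom_Obj[OF lA]
    by (simp_all add: E.Cod_Cmp E.Dom_Cmp AMap_Cmp)
  ultimately show ?thesis by (rule has_trivial_liftI)
qed

lemma trivial_lift_of_refinement:
  assumes P: "is_functor P" and gf: "globally_full Triv P" and st: "strong_subfibration Triv P"
    and triv: "\<forall>f\<in>R. has_trivial_lift P Triv E f"
    and ref: "refines (Tgt P) S R" and s: "s \<in> S" "Dom (Tgt P) s \<in> Obj (Tgt Triv)"
  shows "has_trivial_lift P Triv E s"
proof -
  interpret is_functor P by fact
  interpret B: category "Tgt P" by (rule Tgt_category)
  obtain r h where r: "r \<in> R" and h: "h \<in> Arr (Tgt P)" "Dom (Tgt P) r = Cod (Tgt P) h"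
    "s = Cmp (Tgt P) r h"
    using ref s unfolding refines_def by blast
  obtain t where t: "cartesian P t" "Cod (Src P) t = E" "AMap P t = r" "Dom (Src P) t \<in> Obj (Src Triv)"
    using triv r by (blast elim: has_trivial_liftE)
  have "r \<in> Arr (Tgt P)" using AMap_Arr[OF cartesian_Arr[OF t(1)]] t(3) by simp
  then have "Dom (Tgt P) h \<in> Obj (Tgt Triv)"
    using s h by (simp add: B.Dom_Cmp)
  then show ?thesis
    using trivial_lift_along_factorization[OF P gf st t(1,4) h(1)] h(2,3) t(2,3) by simp
qed

lemma Loc_b_objs_mono:
  assumes "cov_le (Tgt P) (loc_cov P Triv K) (loc_cov P Triv K')"
  shows "Loc_b_objs P Triv K \<subseteq> Loc_b_objs P Triv K'"
  using assms unfolding Loc_b_objs_def cov_le_def loc_cov_def by blast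

lemma Loc_t_objs_mono:
  assumes P: "is_functor P" and gf: "globally_full Triv P" and st: "strong_subfibration Triv P"
    and le: "cov_le (Tgt P) (loc_cov P Triv K) (loc_cov P Triv K')"
  shows "Loc_t_objs P Triv K \<subseteq> Loc_t_objs P Triv K'"
proof
  fix E assume E: "E \<in> Loc_t_objs P Triv K"
  then obtain R where EO: "E \<in> Obj (Src P)" and R: "R \<in> K (OMap P E)"
    and triv: "\<forall>f\<in>R. has_trivial_lift P Triv E f"
    unfolding Loc_t_objs_iff by blast
  have "R \<in> loc_cov P Triv K (OMap P E)"
    using loc_cov_trivializing[where K = K and X = "OMap P E", OF P _ R triv] gf by (simp add: globally_full_def)
  then obtain S where S: "S \<in> loc_cov P Triv K' (OMap P E)" "refines (Tgt P) S R"
    using le is_functor.OMap_Obj[OF P EO] unfolding cov_le_def by blast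
  have "has_trivial_lift P Triv E s"
    if "s \<in> S" for s
    using trivial_lift_of_refinement[OF P gf st triv S(2) that] S(1) that
    by (simp add: loc_cov_def)
  then show "E \<in> Loc_t_objs P Triv K'"
    using EO S(1) unfolding Loc_t_objs_iff loc_cov_def by blast
qed

text \<open>Local triviality is pulled back along \<open>g = P t\<close> by a covering \<open>S\<close> from the coverage axiom. The
  refinement of the trivializing covering by \<open>g S\<close> only yields trivial lifts into the codomain of
  \<open>t\<close>; they are moved to its domain by factoring them through \<open>t\<close>.\<close>

lemma Loc_closed_under_cartesian:
  assumes P: "is_functor P" and gf: "globally_full Triv P" and st: "strong_subfibration Triv P"
    and cov: "coverage (Tgt (Loc P Triv K)) (loc_cov P Triv K)"
  shows "closed_under_cartesian P (Loc_t_objs P Triv K) (Loc_b_objs P Triv K)"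
  unfolding closed_under_cartesian_def
proof (intro allI impI, elim conjE)
  interpret is_functor P by fact
  interpret E: category "Src P" by (rule Src_category)
  interpret B: category "Tgt P" by (rule Tgt_category)
  have sub: "subfunctor Triv P" using gf by (simp add: globally_full_def)
  fix t
  assume t: "cartesian P t" and cod: "Cod (Src P) t \<in> Loc_t_objs P Triv K"
    and dom: "OMap P (Dom (Src P) t) \<in> Loc_b_objs P Triv K"
  let ?D = "Dom (Src P) t" and ?E = "Cod (Src P) t" and ?g = "AMap P t"
  note tA = cartesian_Arr[OF t]
  have g: "?g \<in> Arr (Tgt P)" "Dom (Tgt P) ?g = OMap P ?D" "Cod (Tgt P) ?g = OMap P ?E"
    using tA by (simp_all add: AMap_Arr Dom_AMap Cod_AMap)
  obtain R where R: "R \<in> K (OMap P ?E)"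
    and triv: "\<forall>f\<in>R. has_trivial_lift P Triv ?E f"
    using cod unfolding Loc_t_objs_iff by blast
  have Rl: "R \<in> loc_cov P Triv K (OMap P ?E)"
    by (rule loc_cov_trivializing[where K = K and X = "OMap P ?E", OF P sub R triv])
  have cE: "OMap P ?E \<in> Loc_b_objs P Triv K"
    using OMap_Loc_t_objs[OF P sub cod] .
  have gL: "?g \<in> Arr (Tgt (Loc P Triv K))" "OMap P ?E \<in> Obj (Tgt (Loc P Triv K))"
    "OMap P ?D \<in> Obj (Tgt (Loc P Triv K))"
    using g dom cE tA by (simp_all add: Loc_full_restriction OMap_Obj E.Cod_Obj E.Dom_Obj)
  obtain S where S: "S \<in> loc_cov P Triv K (OMap P ?D)"
    and ref: "refines (Tgt (Loc P Triv K)) (Cmp (Tgt P) ?g ` S) R"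
    using cov Rl gL g unfolding coverage_def by (fastforce simp: Loc_full_restriction)
  have ref': "refines (Tgt P) (Cmp (Tgt P) ?g ` S) R"
    using ref by (fastforce simp: refines_def Loc_full_restriction)
  have "has_trivial_lift P Triv ?D s"
    if s: "s \<in> S" for s
  proof -
    have sA: "s \<in> Arr (Tgt P)" "Cod (Tgt P) s = OMap P ?D" "Dom (Tgt P) s \<in> Obj (Tgt Triv)"
      using cov S s gL(3)
      by (auto simp: coverage_def covering_function_def covering_of_def loc_cov_def
          Loc_full_restriction)
    have gs: "Dom (Tgt P) (Cmp (Tgt P) ?g s) = Dom (Tgt P) s"
      using g sA by (simp add: B.Dom_Cmp)
    have "has_trivial_lift P Triv ?E (Cmp (Tgt P) ?g s)"
      using trivial_lift_of_refinement[OF P gf st triv ref', of "Cmp (Tgt P) ?g s"] s sA(3) gs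
      by simp
    then obtain k where k: "cartesian P k" "Cod (Src P) k = ?E" "AMap P k = Cmp (Tgt P) ?g s"
      "Dom (Src P) k \<in> Obj (Src Triv)"
      by (rule has_trivial_liftE)
    \<comment> \<open>\<open>P k = g s\<close>, so \<open>k\<close> factors through the Cartesian arrow \<open>t\<close> by an arrow over \<open>s\<close>.\<close>
    have "Dom (Tgt P) s = OMap P (Dom (Src P) k)"
      using k gs Dom_AMap[OF cartesian_Arr[OF k(1)]] by simp
    then obtain v where v: "v \<in> Arr (Src P)" "Dom (Src P) v = Dom (Src P) k"
      "Cod (Src P) v = ?D" "AMap P v = s" "Cmp (Src P) t v = k"
      using cartesian_factor[OF t cartesian_Arr[OF k(1)] sA(1) k(2) _ sA(2)] k(3) by metis
    have "cartesian P v"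
      using cartesian_cancel[OF t v(1)] v k by simp
    then show ?thesis using v k by (intro has_trivial_liftI[of P v]) simp_all
  qed
  then show "?D \<in> Loc_t_objs P Triv K"
    using S E.Dom_Obj[OF tA] unfolding Loc_t_objs_iff loc_cov_def by blast
qed

text \<open>Since the isomorphism is vertical, composing it with the trivial lifts leaves the arrows that
  they lie over unchanged, and the same covering trivializes both objects.\<close>

lemma Loc_t_objs_vertical_isomorphism:
  assumes P: "is_functor P" and iso: "isomorphism (Src P) i"
    and vert: "AMap P i = Idt (Tgt P) A" "OMap P (Dom (Src P) i) = A" "OMap P (Cod (Src P) i) = A"
    and dom: "Dom (Src P) i \<in> Loc_t_objs P Triv K"
  shows "Cod (Src P) i \<in> Loc_t_objs P Triv K"
proof -
  interpret is_functor P by fact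
  interpret E: category "Src P" by (rule Src_category)
  interpret B: category "Tgt P" by (rule Tgt_category)
  have iA: "i \<in> Arr (Src P)" using iso by (simp add: isomorphism_def)
  obtain R where R: "R \<in> K A" and triv: "\<forall>f\<in>R. has_trivial_lift P Triv (Dom (Src P) i) f"
    using dom vert(2) unfolding Loc_t_objs_iff by blast
  have "has_trivial_lift P Triv (Cod (Src P) i) f" if f: "f \<in> R" for f
  proof -
    obtain t where t: "cartesian P t" "Cod (Src P) t = Dom (Src P) i" "AMap P t = f"
      "Dom (Src P) t \<in> Obj (Src Triv)"
      using triv f by (blast elim: has_trivial_liftE)
    note tA = cartesian_Arr[OF t(1)]
    have "f \<in> Arr (Tgt P)" "Cod (Tgt P) f = A"
      using t tA vert Cod_AMap[OF tA] AMap_Arr[OF tA] by simp_all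
    then have "AMap P (Cmp (Src P) i t) = f"
      using iA tA t vert B.Idt_Cmp[of f] by (simp add: AMap_Cmp)
    moreover have "cartesian P (Cmp (Src P) i t)"
      using cartesian_Cmp[OF isomorphism_cartesian[OF iso] t(1)] t by simp
    ultimately show ?thesis
      using iA tA t
      by (intro has_trivial_liftI[of P "Cmp (Src P) i t"]) (simp_all add: E.Cod_Cmp E.Dom_Cmp)
  qed
  then show ?thesis
    using R vert(3) E.Cod_Obj[OF iA] unfolding Loc_t_objs_iff by blast
qed

lemma replete_subfunctor_Loc:
  assumes P: "is_functor P" and Triv: "subfunctor Triv P"
    and sub: "Loc_b_objs P Triv K \<subseteq> Loc_b_objs P Triv K'" "Loc_t_objs P Triv K \<subseteq> Loc_t_objs P Triv K'"
  shows "replete_subfunctor (Loc P Triv K) (Loc P Triv K')"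
  unfolding replete_subfunctor_def
proof (intro conjI ballI)
  note maps = OMap_Loc_t_objs[OF P Triv]
  show "subfunctor (Loc P Triv K) (Loc P Triv K')"
    using globally_full_full_restriction[OF P _ _ sub(2,1)] maps
    by (simp add: globally_full_def Loc_full_restriction)
  fix A assume A: "A \<in> Obj (Tgt (Loc P Triv K))"
  interpret L: is_functor "Loc P Triv K'"
    unfolding Loc_full_restriction
    by (rule is_functor.is_functor_full_restriction[OF P]) (rule maps)
  show "replete_in (fibre (Loc P Triv K) A) (fibre (Loc P Triv K') A)"
    unfolding replete_in_def
  proof (intro allI impI, elim conjE)
    fix f assume iso: "isomorphism (fibre (Loc P Triv K') A) f"
      and d: "Dom (fibre (Loc P Triv K') A) f \<in> Obj (fibre (Loc P Triv K) A)"
    have "A \<in> Obj (Tgt (Loc P Triv K'))" using A sub by (auto simp: Loc_full_restriction)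
    note f = fibre_isomorphism[OF L.is_functor_axioms this iso]
    have fP: "isomorphism (Src P) f" "AMap P f = Idt (Tgt P) A"
      "OMap P (Dom (Src P) f) = A" "OMap P (Cod (Src P) f) = A"
      using f isomorphism_full_subcat by (auto simp: Loc_full_restriction)
    have d': "Dom (Src P) f \<in> Loc_t_objs P Triv K"
      using d by (simp add: fibre_def Loc_full_restriction)
    have "Cod (Src P) f \<in> Loc_t_objs P Triv K"
      by (rule Loc_t_objs_vertical_isomorphism[OF P fP d'])
    then show "f \<in> Arr (fibre (Loc P Triv K) A)"
      using d' fP by (simp add: fibre_def Loc_full_restriction isomorphism_def)
  qed
qed



theorem proposition3p3p10:
  fixes P Triv :: "('oe, 'ae, 'ob, 'ab) func"
    and K K' :: "'ob \<Rightarrow> 'ab set set"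
  assumes "fibration P"
    and "covering_function (Tgt P) K" and "axiom_M_tilde (Tgt P) K"
    and "covering_function (Tgt P) K'" and "axiom_M_tilde (Tgt P) K'"
    and "subfunctor_of_trivial_objects Triv P"
    and "replete_subfunctor Triv P" and "globally_full Triv P" and "strong_subfibration Triv P"
    and "cov_le (Tgt P) (loc_cov P Triv K) (loc_cov P Triv K')"
  shows "Loc_b_objs P Triv K \<subseteq> Loc_b_objs P Triv K' \<and>
         Loc_t_objs P Triv K \<subseteq> Loc_t_objs P Triv K' \<and>
         (cov_equiv (Tgt P) (loc_cov P Triv K) (loc_cov P Triv K') \<longrightarrow>
            Loc_b_objs P Triv K = Loc_b_objs P Triv K' \<and>
            Loc_t_objs P Triv K = Loc_t_objs P Triv K') \<and>
         (coverage (Tgt (Loc P Triv K)) (loc_cov P Triv K) \<and>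
          coverage (Tgt (Loc P Triv K')) (loc_cov P Triv K') \<longrightarrow>
            replete_subfunctor (Loc P Triv K) (Loc P Triv K') \<and>
            globally_full (Loc P Triv K) (Loc P Triv K') \<and>
            strong_subfibration (Loc P Triv K) (Loc P Triv K'))"
proof (intro conjI impI; (elim conjE)?)
  have P: "is_functor P" using assms(1) by (simp add: fibration_def)
  note gf = \<open>globally_full Triv P\<close> and st = \<open>strong_subfibration Triv P\<close>
  have sub: "subfunctor Triv P" using gf by (simp add: globally_full_def)
  note maps = OMap_Loc_t_objs[OF P sub]
  note le = assms(10)
  note b = Loc_b_objs_mono[OF le] and t = Loc_t_objs_mono[OF P gf st le]
  show "Loc_b_objs P Triv K \<subseteq> Loc_b_objs P Triv K'" "Loc_t_objs P Triv K \<subseteq> Loc_t_objs P Triv K'"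
    by (fact b t)+
  show "Loc_b_objs P Triv K = Loc_b_objs P Triv K'" "Loc_t_objs P Triv K = Loc_t_objs P Triv K'"
    if "cov_equiv (Tgt P) (loc_cov P Triv K) (loc_cov P Triv K')"
    using that b t Loc_b_objs_mono[of P Triv K' K] Loc_t_objs_mono[OF P gf st, of K' K]
    unfolding cov_equiv_def by blast+
  show "replete_subfunctor (Loc P Triv K) (Loc P Triv K')"
    by (rule replete_subfunctor_Loc[OF P sub b t])
  show "globally_full (Loc P Triv K) (Loc P Triv K')"
    unfolding Loc_full_restriction
    by (rule globally_full_full_restriction[OF P maps maps t b])
  show "strong_subfibration (Loc P Triv K) (Loc P Triv K')"
    if "coverage (Tgt (Loc P Triv K)) (loc_cov P Triv K)"
      "coverage (Tgt (Loc P Triv K')) (loc_cov P Triv K')"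
    unfolding Loc_full_restriction
    using strong_subfibration_full_restriction[OF assms(1) maps maps
        Loc_closed_under_cartesian[OF P gf st that(1)]
        Loc_closed_under_cartesian[OF P gf st that(2)] t b] .
qed

end
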